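(* For every integer $c\ge 3$, there exists a metabelian group $G$ which is infinitely generated (i.e. not finitely generated) such that: (i) $G$ is a residually finite $p$-group for all primes $p$; (ii) $G$ can be generated by a commutator-closed normal subset $T$ satisfying the positive law $M_c(x,y)$; (iii) $G$ does not satisfy any positive law.
   Context: A group word is positive if it does not involve any inverses of the variables (the empty word $1$ is allowed). If $\alpha$ and $\beta$ are two different positive words, a subset $T$ of a group $G$ satisfies the positive law $\alpha\equiv\beta$ if every substitution of elements of $T$ for the variables gives the same value (in $G$) for $\alpha$ and for $\beta$. A group satisfies a positive law if it satisfies $\alpha\equiv\beta$ for some pair of different positive words $\alpha,\beta$. Malcev law: define positive words in two variables $x,y$ by $\alpha_0=x$, $\beta_0=y$, and $\alpha_c=\alpha_{c-1}\beta_{c-1}$, $\beta_c=\beta_{c-1}\alpha_{c-1}$ for $c\ge 1$. The Malcev law $M_c(x,y)$ ($c\ge 1$) is the positive law $\alpha_c(x,y)\equiv\beta_c(x,y)$. A subset $T$ of $G$ is normal if it is closed under conjugation by elements of $G$, and commutator-closed if $[x,y]=x^{-1}y^{-1}xy\in T$ for all $x,y\in T$. "$G$ is a residually finite $p$-group" means $G$ is residually-(finite $p$-group): for every $1\ne g\in G$ there is a normal subgroup $N$ of $G$ with $g\notin N$ and $G/N$ a finite $p$-group. *)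

theory Defs
  imports "HOL-Algebra.Generated_Groups" "HOL-Computational_Algebra.Primes"
begin

text \<open>A positive word is a list of variables, and the variables are indexed by natural numbers.
  Two positive words are different iff they differ as lists.\<close>

type_synonym pos_word = "nat list"

definition eval_word :: "('a, 'b) monoid_scheme \<Rightarrow> (nat \<Rightarrow> 'a) \<Rightarrow> pos_word \<Rightarrow> 'a" where
  "eval_word G \<theta> w = foldr (\<lambda>v a. \<theta> v \<otimes>\<^bsub>G\<^esub> a) w \<one>\<^bsub>G\<^esub>"

definition satisfies_law :: "('a, 'b) monoid_scheme \<Rightarrow> 'a set \<Rightarrow> pos_word \<Rightarrow> pos_word \<Rightarrow> bool" where
  "satisfies_law G T \<alpha> \<beta> \<longleftrightarrow>
     (\<forall>\<theta>. (\<forall>v. \<theta> v \<in> T) \<longrightarrow> eval_word G \<theta> \<alpha> = eval_word G \<theta> \<beta>)"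

definition satisfies_positive_law :: "('a, 'b) monoid_scheme \<Rightarrow> bool" where
  "satisfies_positive_law G \<longleftrightarrow> (\<exists>\<alpha> \<beta>. \<alpha> \<noteq> \<beta> \<and> satisfies_law G (carrier G) \<alpha> \<beta>)"

text \<open>The two Malcev words; the variables \<open>x\<close> and \<open>y\<close> are \<open>0\<close> and \<open>1\<close>.\<close>

fun malcev_\<alpha> :: "nat \<Rightarrow> pos_word" and malcev_\<beta> :: "nat \<Rightarrow> pos_word" where
  "malcev_\<alpha> 0 = [0]"
| "malcev_\<alpha> (Suc c) = malcev_\<alpha> c @ malcev_\<beta> c"
| "malcev_\<beta> 0 = [1]"
| "malcev_\<beta> (Suc c) = malcev_\<beta> c @ malcev_\<alpha> c"

definition normal_subset :: "('a, 'b) monoid_scheme \<Rightarrow> 'a set \<Rightarrow> bool" where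
  "normal_subset G T \<longleftrightarrow> T \<subseteq> carrier G \<and>
     (\<forall>g\<in>carrier G. \<forall>t\<in>T. inv\<^bsub>G\<^esub> g \<otimes>\<^bsub>G\<^esub> t \<otimes>\<^bsub>G\<^esub> g \<in> T)"

definition commutator_closed :: "('a, 'b) monoid_scheme \<Rightarrow> 'a set \<Rightarrow> bool" where
  "commutator_closed G T \<longleftrightarrow>
     (\<forall>x\<in>T. \<forall>y\<in>T. inv\<^bsub>G\<^esub> x \<otimes>\<^bsub>G\<^esub> inv\<^bsub>G\<^esub> y \<otimes>\<^bsub>G\<^esub> x \<otimes>\<^bsub>G\<^esub> y \<in> T)"

definition finitely_generated :: "('a, 'b) monoid_scheme \<Rightarrow> bool" where
  "finitely_generated G \<longleftrightarrow> (\<exists>S. finite S \<and> S \<subseteq> carrier G \<and> generate G S = carrier G)"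

definition metabelian :: "('a, 'b) monoid_scheme \<Rightarrow> bool" where
  "metabelian G \<longleftrightarrow> group G \<and> derived G (derived G (carrier G)) = {\<one>\<^bsub>G\<^esub>}"

definition finite_p_group :: "nat \<Rightarrow> ('a, 'b) monoid_scheme \<Rightarrow> bool" where
  "finite_p_group p G \<longleftrightarrow> group G \<and> finite (carrier G) \<and> (\<exists>k. order G = p ^ k)"

definition residually_finite_p_group :: "nat \<Rightarrow> ('a, 'b) monoid_scheme \<Rightarrow> bool" where
  "residually_finite_p_group p G \<longleftrightarrow>
     (\<forall>g\<in>carrier G. g \<noteq> \<one>\<^bsub>G\<^esub> \<longrightarrow> (\<exists>N. N \<lhd> G \<and> g \<notin> N \<and> finite_p_group p (G Mod N)))"

end

theory Submission
  imports
    Defs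
    "HOL-Algebra.Sylow"
    "HOL-Algebra.Multiplicative_Group"
    "HOL-Library.Function_Algebras"
    "HOL-Library.Countable_Set"
begin

text \<open>
  Let \<open>A\<close> be the direct sum over \<open>n\<close> of the groups of integer-valued functions of
  \<open>x\<^sub>0, \<dots>, x\<^sub>n\<^sub>-\<^sub>1\<close> that are affine in each variable separately, and let the free abelian group \<open>Q\<close> on
  \<open>e\<^sub>0, e\<^sub>1, \<dots>\<close> act on \<open>A\<close> by translating the argument. The group is \<open>A \<rtimes> Q\<close>. Every \<open>e\<^sub>i\<close> acts with
  \<open>(e\<^sub>i - 1)\<^sup>2 = 0\<close>; hence two elements of \<open>T = A \<union> {f e\<^sub>i | (e\<^sub>i - 1) f = 0}\<close> generate a group of class at
  most two, and \<open>T\<close> satisfies even \<open>M\<^sub>2\<close>. On the other hand \<open>e\<^sub>0 + \<dots> + e\<^sub>L\<^sub>-\<^sub>1\<close> has unbounded degree of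
  unipotency: a positive law between words of length \<open>L\<close> that differ at position \<open>m\<close> is refuted by
  translating the Lagrange-type product of the \<open>x\<^sub>i\<close> with \<open>i \<noteq> m\<close>. Since translation by multiples of \<open>p\<^sup>k\<close> is
  trivial modulo \<open>p\<^sup>k\<close>, reduction modulo \<open>p\<^sup>k\<close> yields enough finite \<open>p\<close>-quotients.
\<close>

section \<open>Words and the Malcev law\<close>

lemma eval_word_Nil [simp]: "eval_word G \<theta> [] = \<one>\<^bsub>G\<^esub>"
  and eval_word_Cons [simp]: "eval_word G \<theta> (v # w) = \<theta> v \<otimes>\<^bsub>G\<^esub> eval_word G \<theta> w"
  by (simp_all add: eval_word_def)

context monoid
begin

lemma eval_word_closed [simp]:
  assumes "\<And>v. \<theta> v \<in> carrier G"
  shows "eval_word G \<theta> w \<in> carrier G"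
  using assms by (induction w) auto

lemma eval_word_append:
  assumes "\<And>v. \<theta> v \<in> carrier G"
  shows "eval_word G \<theta> (u @ w) = eval_word G \<theta> u \<otimes> eval_word G \<theta> w"
  using assms by (induction u) (auto simp: m_assoc)

text \<open>The hypothesis \<open>comm\<close> is the law of level 2 itself, since the words there
  are \<open>xyyx\<close> and \<open>yxxy\<close>. Once the two words of some level have equal
  values, the next level compares a square with itself, so the law passes to every higher
  \<open>c\<close>.\<close>

lemma satisfies_law_malcev:
  assumes T: "T \<subseteq> carrier G"
    and comm: "\<And>x y. x \<in> T \<Longrightarrow> y \<in> T \<Longrightarrow> (x \<otimes> y) \<otimes> (y \<otimes> x) = (y \<otimes> x) \<otimes> (x \<otimes> y)"
    and "c \<ge> 2"
  shows "satisfies_law G T (malcev_\<alpha> c) (malcev_\<beta> c)"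
  unfolding satisfies_law_def
proof (intro allI impI)
  fix \<theta> :: "nat \<Rightarrow> 'a"
  assume \<theta>: "\<forall>v. \<theta> v \<in> T"
  then have carr: "\<And>v. \<theta> v \<in> carrier G"
    using T by auto
  show "eval_word G \<theta> (malcev_\<alpha> c) = eval_word G \<theta> (malcev_\<beta> c)"
    using \<open>c \<ge> 2\<close>
  proof (induction c rule: dec_induct)
    case base
    show ?case
      using comm[of "\<theta> 0" "\<theta> 1"] \<theta> carr by (simp add: numeral_2_eq_2 m_assoc)
  next
    case (step n)
    then show ?case
      by (simp add: eval_word_append carr)
  qed
qed

end

section \<open>Invariance under isomorphism\<close>

lemma (in group_hom) hom_eval_word:
  assumes "\<And>v. \<theta> v \<in> carrier G"
  shows "h (eval_word G \<theta> w) = eval_word H (\<lambda>v. h (\<theta> v)) w"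
  using assms by (induction w) auto

lemma (in group_hom) finitely_generated_image:
  assumes "finitely_generated G" "h ` carrier G = carrier H"
  shows "finitely_generated H"
proof -
  obtain S where "finite S" "S \<subseteq> carrier G" "generate G S = carrier G"
    using assms(1) by (auto simp: finitely_generated_def)
  then show ?thesis
    unfolding finitely_generated_def using generate_img[of S] assms(2)
    by (intro exI[of _ "h ` S"]) auto
qed

lemma (in group_hom) metabelian_image:
  assumes "metabelian G" "h ` carrier G = carrier H"
  shows "metabelian H"
proof -
  have "derived H (derived H (h ` carrier G)) = h ` derived G (derived G (carrier G))"
    by (simp add: derived_img G.derived_in_carrier)
  then show ?thesis
    using assms by (simp add: metabelian_def)
qed

lemma (in group_hom) satisfies_law_image:
  assumes T: "T \<subseteq> carrier G" and law: "satisfies_law G T \<alpha> \<beta>"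
  shows "satisfies_law H (h ` T) \<alpha> \<beta>"
  unfolding satisfies_law_def
proof (intro allI impI)
  fix \<theta> :: "nat \<Rightarrow> 'c"
  assume \<theta>: "\<forall>v. \<theta> v \<in> h ` T"
  \<comment> \<open>A substitution into the image is lifted one variable at a time; the preimages
    are chosen inside \<open>T\<close>, where the law is available.\<close>
  define \<theta>' where "\<theta>' v = inv_into T h (\<theta> v)" for v
  have \<theta>'_T: "\<theta>' v \<in> T" for v
    using \<theta> by (simp add: \<theta>'_def inv_into_into)
  then have "\<And>v. \<theta>' v \<in> carrier G"
    using T by auto
  moreover have "\<theta> = (\<lambda>v. h (\<theta>' v))"
    using \<theta> by (simp add: \<theta>'_def f_inv_into_f)
  moreover have "eval_word G \<theta>' \<alpha> = eval_word G \<theta>' \<beta>"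
    using law \<theta>'_T by (simp add: satisfies_law_def)
  ultimately show "eval_word H \<theta> \<alpha> = eval_word H \<theta> \<beta>"
    by (simp flip: hom_eval_word)
qed

lemma (in group_hom) normal_subset_image:
  assumes "normal_subset G T" "h ` carrier G = carrier H"
  shows "normal_subset H (h ` T)"
  unfolding normal_subset_def
proof (intro conjI ballI)
  show "h ` T \<subseteq> carrier H"
    using assms by (auto simp: normal_subset_def)
next
  fix k s assume "k \<in> carrier H" "s \<in> h ` T"
  then obtain g t where gt: "g \<in> carrier G" "k = h g" "t \<in> T" "s = h t"
    using assms(2) by (metis imageE)
  moreover have "t \<in> carrier G" "inv\<^bsub>G\<^esub> g \<otimes>\<^bsub>G\<^esub> t \<otimes>\<^bsub>G\<^esub> g \<in> T"
    using gt assms(1) by (auto simp: normal_subset_def)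
  ultimately show "inv\<^bsub>H\<^esub> k \<otimes>\<^bsub>H\<^esub> s \<otimes>\<^bsub>H\<^esub> k \<in> h ` T"
    by (intro image_eqI[of _ h "inv\<^bsub>G\<^esub> g \<otimes>\<^bsub>G\<^esub> t \<otimes>\<^bsub>G\<^esub> g"]) simp_all
qed

lemma (in group_hom) commutator_closed_image:
  assumes T: "T \<subseteq> carrier G" and "commutator_closed G T"
  shows "commutator_closed H (h ` T)"
  unfolding commutator_closed_def
proof (intro ballI)
  fix x y assume "x \<in> h ` T" "y \<in> h ` T"
  then obtain s t where st: "s \<in> T" "t \<in> T" "x = h s" "y = h t"
    by (metis imageE)
  moreover have "s \<in> carrier G" "t \<in> carrier G"
    using st T by auto
  moreover have "inv\<^bsub>G\<^esub> s \<otimes>\<^bsub>G\<^esub> inv\<^bsub>G\<^esub> t \<otimes>\<^bsub>G\<^esub> s \<otimes>\<^bsub>G\<^esub> t \<in> T"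
    using st assms(2) by (auto simp: commutator_closed_def)
  ultimately show "inv\<^bsub>H\<^esub> x \<otimes>\<^bsub>H\<^esub> inv\<^bsub>H\<^esub> y \<otimes>\<^bsub>H\<^esub> x \<otimes>\<^bsub>H\<^esub> y \<in> h ` T"
    by (intro image_eqI[of _ h "inv\<^bsub>G\<^esub> s \<otimes>\<^bsub>G\<^esub> inv\<^bsub>G\<^esub> t \<otimes>\<^bsub>G\<^esub> s \<otimes>\<^bsub>G\<^esub> t"]) simp_all
qed

lemma finite_p_group_iso:
  assumes "group G" "h \<in> iso G H" "finite_p_group p H"
  shows "finite_p_group p G"
proof -
  have "bij_betw h (carrier G) (carrier H)"
    using assms(2) by (simp add: iso_def)
  then show ?thesis
    using assms by (auto simp: finite_p_group_def order_def bij_betw_same_card dest: bij_betw_finite)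
qed

text \<open>A normal subgroup \<open>N\<close> of \<open>H\<close> is pulled back as the kernel of
  the composite of \<open>h\<close> with the projection to \<open>H Mod N\<close>. The first
  isomorphism theorem identifies the quotient of \<open>G\<close> by this kernel with
  \<open>H Mod N\<close>.\<close>

lemma residually_finite_p_group_iso:
  assumes "group G" "group H" and h: "h \<in> iso G H" and res: "residually_finite_p_group p H"
  shows "residually_finite_p_group p G"
  unfolding residually_finite_p_group_def
proof (intro ballI impI)
  interpret G: group G by fact
  interpret H: group H by fact
  interpret h: group_hom G H h
    using h by unfold_locales (simp add: iso_def)
  fix g assume g: "g \<in> carrier G" "g \<noteq> \<one>\<^bsub>G\<^esub>"
  have bij: "bij_betw h (carrier G) (carrier H)"
    using h by (simp add: iso_def)
  then have "h g \<noteq> \<one>\<^bsub>H\<^esub>"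
    using g by (metis G.one_closed bij_betw_imp_inj_on h.hom_one inj_onD)
  then obtain N where N: "N \<lhd> H" "h g \<notin> N" "finite_p_group p (H Mod N)"
    using res g h.hom_closed by (auto simp: residually_finite_p_group_def)
  interpret N: normal N H by fact
  define k where "k = (\<lambda>a. N #>\<^bsub>H\<^esub> h a)"
  have "k \<in> hom G (H Mod N)"
    using hom_compose[OF h.homh N.r_coset_hom_Mod] by (simp add: k_def o_def)
  then interpret k: group_hom G "H Mod N" k
    using N.factorgroup_is_group by (simp add: group_hom_def group_hom_axioms_def)
  have "carrier (H Mod N) = (\<lambda>a. N #>\<^bsub>H\<^esub> a) ` h ` carrier G"
    using bij by (auto simp: bij_betw_imp_surj_on FactGroup_def RCOSETS_def)
  then have surj: "k ` carrier G = carrier (H Mod N)"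
    by (simp add: k_def image_image)
  have "g \<notin> kernel G (H Mod N) k"
  proof
    assume "g \<in> kernel G (H Mod N) k"
    then have "N #>\<^bsub>H\<^esub> h g = N"
      by (simp add: kernel_def k_def)
    then show False
      using N(2) H.coset_join1[of N "h g"] g N.subgroup_axioms by simp
  qed
  moreover have "finite_p_group p (G Mod kernel G (H Mod N) k)"
    using finite_p_group_iso[OF _ k.FactGroup_iso_set[OF surj] N(3)]
      normal.factorgroup_is_group[OF k.normal_kernel] by blast
  ultimately show "\<exists>N. N \<lhd> G \<and> g \<notin> N \<and> finite_p_group p (G Mod N)"
    using k.normal_kernel by blast
qed

text \<open>This moves the construction to a group whose elements are natural numbers. Elements are
  encoded by an enumeration, and a product is computed by decoding, multiplying and encoding
  again.\<close>

lemma countable_group_iso_nat: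
  fixes H :: "('a, 'b) monoid_scheme"
  assumes "group H" "countable (carrier H)"
  obtains G :: "nat monoid" and h where "group G" "h \<in> iso H G"
proof -
  interpret group H by fact
  define e where "e = to_nat_on (carrier H)"
  define d where "d = from_nat_into (carrier H)"
  have de [simp]: "x \<in> carrier H \<Longrightarrow> d (e x) = x" for x
    using assms(2) by (simp add: d_def e_def)
  define G :: "nat monoid" where
    "G = \<lparr>carrier = e ` carrier H, monoid.mult = (\<lambda>x y. e (d x \<otimes>\<^bsub>H\<^esub> d y)), one = e \<one>\<^bsub>H\<^esub>\<rparr>"
  have iso: "e \<in> iso H G"
    by (auto simp: iso_def hom_def bij_betw_def G_def intro: inj_on_inverseI[where g = d])
  moreover have "group G"
    using iso_imp_img_group[OF iso] by (simp add: G_def)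
  ultimately show thesis
    using that by blast
qed

section \<open>A criterion for finite \<open>p\<close>-quotients\<close>

text \<open>By Cauchy's theorem, here the Sylow theorem with exponent 1, a prime divisor
  \<open>r\<close> of the order other than \<open>p\<close> would give a subgroup of order
  \<open>r\<close>. The order of a nontrivial element of it would divide both \<open>r\<close> and
  \<open>p ^ e\<close>, which are coprime.\<close>

lemma order_prime_power_if_exponent:
  fixes G (structure)
  assumes "group G" "finite (carrier G)" "prime p"
    and expo: "\<And>x. x \<in> carrier G \<Longrightarrow> x [^] (p ^ e :: nat) = \<one>"
  shows "\<exists>k. order G = p ^ k"
proof -
  interpret group G by fact
  have "order G > 0"
    using assms(2) by (simp add: order_gt_0_iff_finite)
  then obtain k n where kn: "\<not> p dvd n" "order G = n * p ^ k"
    using prime_power_canonical[OF \<open>prime p\<close>] by blast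
  have "n = 1"
  proof (rule ccontr)
    assume "n \<noteq> 1"
    then obtain r where r: "prime r" "r dvd n"
      using prime_factor_nat by blast
    then obtain m where "order G = r ^ 1 * m"
      using kn by (metis dvd_def dvd_mult2 power_one_right)
    then obtain K where K: "subgroup K G" "card K = r"
      using sylow_thm[OF r(1), of G 1 m] assms by auto
    then have "K \<noteq> {\<one>}"
      using r(1) by auto
    then obtain x where x: "x \<in> K" "x \<noteq> \<one>"
      using K subgroup.one_closed by fastforce
    have xG: "x \<in> carrier G"
      using x K subgroup.mem_carrier by metis
    interpret K: group "G\<lparr>carrier := K\<rparr>"
      using K subgroup_imp_group by blast
    have "x [^]\<^bsub>G\<lparr>carrier := K\<rparr>\<^esub> order (G\<lparr>carrier := K\<rparr>) = \<one>"
      using K.pow_order_eq_1[of x] x by simp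
    then have "x [^] r = \<one>"
      using K by (simp add: order_def nat_pow_consistent[symmetric])
    then have "ord x dvd r" "ord x dvd p ^ e"
      using xG expo[OF xG] pow_eq_id by blast+
    moreover have "coprime r (p ^ e)"
      using r kn(1) \<open>prime p\<close> by (metis coprime_power_right_iff primes_coprime)
    ultimately have "ord x = 1"
      using coprime_common_divisor_nat by blast
    then show False
      using x xG ord_eq_1 by blast
  qed
  then show ?thesis
    using kn by auto
qed

text \<open>Finite index and a bounded \<open>p\<close>-power exponent suffice, so the index of a
  subgroup never has to be computed.\<close>

lemma (in normal) FactGroup_finite_p_group:
  assumes "finite (rcosets H)" "prime p"
    and expo: "\<And>x. x \<in> carrier G \<Longrightarrow> x [^] (p ^ e :: nat) \<in> H"
  shows "finite_p_group p (G Mod H)"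
proof -
  interpret Q: group "G Mod H"
    by (rule factorgroup_is_group)
  interpret \<pi>: group_hom G "G Mod H" "\<lambda>a. H #> a"
    using r_coset_hom_Mod by unfold_locales
  have fin: "finite (carrier (G Mod H))"
    using assms(1) by (simp add: FactGroup_def)
  have "X [^]\<^bsub>G Mod H\<^esub> (p ^ e) = \<one>\<^bsub>G Mod H\<^esub>" if X: "X \<in> carrier (G Mod H)" for X
  proof -
    obtain x where x: "x \<in> carrier G" "X = H #> x"
      using X by (auto simp: FactGroup_def RCOSETS_def)
    then have "X [^]\<^bsub>G Mod H\<^esub> (p ^ e) = H #> (x [^] (p ^ e))"
      by (simp add: \<pi>.hom_nat_pow)
    also have "\<dots> = H"
      using expo[OF x(1)] x(1) by (simp add: coset_join2 subgroup_axioms)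
    finally show ?thesis
      by simp
  qed
  then show ?thesis
    using order_prime_power_if_exponent[OF Q.is_group fin \<open>prime p\<close>] fin Q.is_group
    by (auto simp: finite_p_group_def)
qed

section \<open>Multiaffine functions\<close>

text \<open>Arguments are infinite sequences even though only the first \<open>n\<close> entries
  matter, so that one translation group acts on these functions for all \<open>n\<close> at once.
  Affinity is stated as interpolation from the values at 0 and 1, which stays within the
  integers.\<close>

definition multiaffine :: "nat \<Rightarrow> ((nat \<Rightarrow> int) \<Rightarrow> int) \<Rightarrow> bool" where
  "multiaffine n f \<longleftrightarrow>
     (\<forall>x y. (\<forall>i<n. x i = y i) \<longrightarrow> f x = f y) \<and>
     (\<forall>x i a. f (x(i := a)) = f (x(i := 0)) + a * (f (x(i := 1)) - f (x(i := 0))))"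

lemma multiaffine_cong:
  "multiaffine n f \<Longrightarrow> (\<And>i. i < n \<Longrightarrow> x i = y i) \<Longrightarrow> f x = f y"
  unfolding multiaffine_def by blast

lemma multiaffine_upd:
  "multiaffine n f \<Longrightarrow> f (x(i := a)) = f (x(i := 0)) + a * (f (x(i := 1)) - f (x(i := 0)))"
  unfolding multiaffine_def by blast

lemma multiaffine_zero [simp]: "multiaffine n (\<lambda>x. 0)"
  by (simp add: multiaffine_def)

lemma multiaffine_add:
  assumes "multiaffine n f" "multiaffine n g"
  shows "multiaffine n (\<lambda>x. f x + g x)"
  unfolding multiaffine_def
proof (intro conjI allI impI)
  show "f x + g x = f y + g y" if "\<forall>i<n. x i = y i" for x y
    using multiaffine_cong[OF assms(1), of x y] multiaffine_cong[OF assms(2), of x y] that by simp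
  show "f (x(i := a)) + g (x(i := a)) =
        f (x(i := 0)) + g (x(i := 0)) + a * (f (x(i := 1)) + g (x(i := 1)) - (f (x(i := 0)) + g (x(i := 0))))" for x i a
    unfolding multiaffine_upd[OF assms(1), of x i a] multiaffine_upd[OF assms(2), of x i a]
    by (simp add: algebra_simps)
qed

lemma multiaffine_uminus:
  assumes "multiaffine n f"
  shows "multiaffine n (\<lambda>x. - f x)"
  unfolding multiaffine_def
proof (intro conjI allI impI)
  show "- f x = - f y" if "\<forall>i<n. x i = y i" for x y
    using multiaffine_cong[OF assms, of x y] that by simp
  show "- f (x(i := a)) = - f (x(i := 0)) + a * (- f (x(i := 1)) - - f (x(i := 0)))" for x i a
    unfolding multiaffine_upd[OF assms, of x i a] by (simp add: algebra_simps)
qed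

lemma multiaffine_diff:
  "multiaffine n f \<Longrightarrow> multiaffine n g \<Longrightarrow> multiaffine n (\<lambda>x. f x - g x)"
  using multiaffine_add[OF _ multiaffine_uminus, of n f g] by simp

lemma multiaffine_translate:
  assumes "multiaffine n f"
  shows "multiaffine n (\<lambda>x. f (x + q))"
  unfolding multiaffine_def
proof (intro conjI allI impI)
  show "f (x + q) = f (y + q)" if "\<forall>i<n. x i = y i" for x y
    using that by (intro multiaffine_cong[OF assms]) simp
  show "f (x(i := a) + q) = f (x(i := 0) + q) + a * (f (x(i := 1) + q) - f (x(i := 0) + q))" for x i a
  proof -
    have upd: "x(i := b) + q = (x + q)(i := b + q i)" for b
      by (auto simp: fun_eq_iff)
    show ?thesis
      unfolding upd multiaffine_upd[OF assms, of "x + q" i "_ + _"] by (simp add: algebra_simps)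
  qed
qed

definition unit_vec :: "nat \<Rightarrow> nat \<Rightarrow> int" where
  "unit_vec i = (\<lambda>j. if j = i then 1 else 0)"

text \<open>Along the direction of coordinate \<open>i\<close> the function is affine, so its second
  difference vanishes. This is the identity \<open>(e_i - 1)^2 = 0\<close> on which the generating
  set rests.\<close>

lemma multiaffine_second_difference:
  assumes "multiaffine n f"
  shows "f (x + (unit_vec i + unit_vec i)) = 2 * f (x + unit_vec i) - f x"
proof -
  have "x + (unit_vec i + unit_vec i) = x(i := x i + 2)" "x + unit_vec i = x(i := x i + 1)" "x = x(i := x i)"
    by (auto simp: unit_vec_def fun_eq_iff)
  then show ?thesis
    using multiaffine_upd[OF assms, of x i "x i + 2"] multiaffine_upd[OF assms, of x i "x i + 1"]
      multiaffine_upd[OF assms, of x i "x i"]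
    by (simp add: algebra_simps)
qed

text \<open>Coordinates are shifted one at a time. Shifting coordinate \<open>k\<close> changes the
  value by \<open>q k\<close> times an integer slope, hence by a multiple of
  \<open>m\<close>.\<close>

lemma multiaffine_translate_dvd:
  assumes f: "multiaffine n f" and q: "\<And>i. i < n \<Longrightarrow> m dvd q i"
  shows "m dvd f (x + q) - f x"
proof -
  define z where "z k = (\<lambda>i. if i < k then x i + q i else x i)" for k
  have "m dvd f (z k) - f x" if "k \<le> n" for k
    using that
  proof (induction k)
    case 0
    then show ?case by (simp add: z_def)
  next
    case (Suc k)
    have "z (Suc k) = (z k)(k := x k + q k)" "z k = (z k)(k := x k)"
      by (auto simp: z_def fun_eq_iff)
    then have "f (z (Suc k)) - f (z k) = q k * (f ((z k)(k := 1)) - f ((z k)(k := 0)))"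
      using multiaffine_upd[OF f, of "z k" k "x k + q k"] multiaffine_upd[OF f, of "z k" k "x k"]
      by (simp add: algebra_simps)
    moreover have "m dvd q k"
      using q Suc.prems by simp
    ultimately have "m dvd f (z (Suc k)) - f (z k)"
      by simp
    then have "m dvd (f (z (Suc k)) - f (z k)) + (f (z k) - f x)"
      using Suc by (intro dvd_add) auto
    then show ?case by simp
  qed
  \<comment> \<open>The points \<open>z n\<close> and \<open>x + q\<close> may differ from index
    \<open>n\<close> on, which \<open>f\<close> does not see.\<close>
  moreover have "f (z n) = f (x + q)"
    by (rule multiaffine_cong[OF f]) (simp add: z_def)
  ultimately show ?thesis
    by fastforce
qed

text \<open>Every value is an integer combination of the values at the vertices of the 0-1 cube.
  With \<open>m\<close> positive this bounds the number of residue patterns; with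
  \<open>m = 0\<close> it says that the vertices determine the function.\<close>

lemma multiaffine_dvd_if_dvd_on_cube:
  assumes f: "multiaffine n f"
    and cube: "\<And>S. S \<subseteq> {..<n} \<Longrightarrow> m dvd f (\<lambda>i. of_bool (i \<in> S))"
  shows "m dvd f x"
proof -
  \<comment> \<open>The induction is on the number \<open>k\<close> of leading coordinates that are
    no longer confined to 0 and 1; each step interpolates in one of them.\<close>
  have "m dvd f x" if "\<forall>i<n. k \<le> i \<longrightarrow> x i \<in> {0, 1}" for k x
    using that
  proof (induction k arbitrary: x)
    case 0
    have "f x = f (\<lambda>i. of_bool (i \<in> {i. i < n \<and> x i = 1}))"
      using 0 by (intro multiaffine_cong[OF f]) auto
    then show ?case
      using cube[of "{i. i < n \<and> x i = 1}"] by auto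
  next
    case (Suc k)
    have "\<forall>i<n. k \<le> i \<longrightarrow> (x(k := b)) i \<in> {0, 1}" if "b \<in> {0, 1}" for b
      using Suc.prems that by (metis Suc_leI fun_upd_apply le_neq_implies_less)
    then have "m dvd f (x(k := 0))" "m dvd f (x(k := 1))"
      by (blast intro: Suc.IH)+
    then have "m dvd f (x(k := x k))"
      unfolding multiaffine_upd[OF f, of x k "x k"] by auto
    then show ?case by simp
  qed
  from this[of n] show ?thesis by auto
qed

lemma multiaffine_prod:
  assumes "S \<subseteq> {..<n}"
  shows "multiaffine n (\<lambda>x. \<Prod>i\<in>S. x i)"
  unfolding multiaffine_def
proof (intro conjI allI impI)
  show "prod x S = prod y S" if "\<forall>i<n. x i = y i" for x y
    using that assms by (intro prod.cong) auto
  have fin: "finite S"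
    using assms finite_subset by blast
  show "prod (x(i := a)) S = prod (x(i := 0)) S + a * (prod (x(i := 1)) S - prod (x(i := 0)) S)" for x i and a :: int
  proof (cases "i \<in> S")
    case True
    have "prod (x(i := b)) S = b * prod x (S - {i})" for b
      using True fin by (subst prod.remove[of _ i]) auto
    then show ?thesis by simp
  next
    case False
    then have "prod (x(i := b)) S = prod x S" for b
      by (intro prod.cong) auto
    then show ?thesis by simp
  qed
qed

section \<open>The split extension\<close>

type_synonym family = "nat \<Rightarrow> (nat \<Rightarrow> int) \<Rightarrow> int"

text \<open>Finite support, here and in \<open>finitary\<close>, keeps the group countable, as the
  transfer to natural numbers requires.\<close>

definition families :: "family set" where
  "families = {f. (\<forall>n. multiaffine n (f n)) \<and> (\<exists>k. \<forall>n\<ge>k. f n = 0)}"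

definition finitary :: "(nat \<Rightarrow> int) set" where
  "finitary = {q. \<exists>k. \<forall>i\<ge>k. q i = 0}"

definition translation_group :: "(family \<times> (nat \<Rightarrow> int)) monoid" where
  "translation_group =
     \<lparr>carrier = families \<times> finitary,
      monoid.mult = (\<lambda>(f, q) (g, r). ((\<lambda>n x. f n x + g n (x + q)), q + r)),
      one = (0, 0)\<rparr>"

abbreviation "\<Gamma> \<equiv> translation_group"

lemma carrier_translation_group [simp]:
  "(f, q) \<in> carrier \<Gamma> \<longleftrightarrow> f \<in> families \<and> q \<in> finitary"
  by (simp add: translation_group_def)

lemma mult_translation_group [simp]:
  "(f, q) \<otimes>\<^bsub>\<Gamma>\<^esub> (g, r) = ((\<lambda>n x. f n x + g n (x + q)), q + r)"
  by (simp add: translation_group_def)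

lemma one_translation_group [simp]: "\<one>\<^bsub>\<Gamma>\<^esub> = (0, 0)"
  by (simp add: translation_group_def)

lemma families_multiaffine: "f \<in> families \<Longrightarrow> multiaffine n (f n)"
  by (simp add: families_def)

lemma families_0 [simp]: "0 \<in> families"
  by (simp add: families_def zero_fun_def)

lemma families_add:
  assumes "f \<in> families" "g \<in> families"
  shows "(\<lambda>n x. f n x + g n x) \<in> families"
proof -
  obtain k l where "\<forall>n\<ge>k. f n = 0" "\<forall>n\<ge>l. g n = 0"
    using assms by (auto simp: families_def)
  then have "\<forall>n\<ge>max k l. (\<lambda>x. f n x + g n x) = 0"
    by (auto simp: fun_eq_iff)
  then show ?thesis
    using assms multiaffine_add unfolding families_def by blast
qed

lemma families_uminus:
  assumes "f \<in> families"
  shows "(\<lambda>n x. - f n x) \<in> families"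
proof -
  obtain k where "\<forall>n\<ge>k. f n = 0"
    using assms by (auto simp: families_def)
  then have "\<forall>n\<ge>k. (\<lambda>x. - f n x) = 0"
    by (auto simp: fun_eq_iff)
  then show ?thesis
    using assms multiaffine_uminus unfolding families_def by blast
qed

lemma families_translate:
  assumes "f \<in> families"
  shows "(\<lambda>n x. f n (x + q)) \<in> families"
proof -
  obtain k where "\<forall>n\<ge>k. f n = 0"
    using assms by (auto simp: families_def)
  then have "\<forall>n\<ge>k. (\<lambda>x. f n (x + q)) = 0"
    by (auto simp: fun_eq_iff)
  then show ?thesis
    using assms multiaffine_translate unfolding families_def by blast
qed

lemma finitary_0 [simp]: "0 \<in> finitary"
  by (simp add: finitary_def)

lemma finitary_unit_vec [simp]: "unit_vec i \<in> finitary"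
  unfolding finitary_def unit_vec_def by (auto intro!: exI[of _ "Suc i"])

lemma finitary_add [simp]: "q \<in> finitary \<Longrightarrow> r \<in> finitary \<Longrightarrow> q + r \<in> finitary"
proof -
  assume "q \<in> finitary" "r \<in> finitary"
  then obtain k l where "\<forall>i\<ge>k. q i = 0" "\<forall>i\<ge>l. r i = 0"
    by (auto simp: finitary_def)
  then have "\<forall>i\<ge>max k l. (q + r) i = 0"
    by auto
  then show ?thesis
    unfolding finitary_def by blast
qed

lemma finitary_uminus [simp]: "q \<in> finitary \<Longrightarrow> - q \<in> finitary"
  by (auto simp: finitary_def)

lemma translation_group_inverse:
  assumes "(f, q) \<in> carrier \<Gamma>"
  shows "((\<lambda>n x. - f n (x + - q)), - q) \<in> carrier \<Gamma>"
    and "((\<lambda>n x. - f n (x + - q)), - q) \<otimes>\<^bsub>\<Gamma>\<^esub> (f, q) = \<one>\<^bsub>\<Gamma>\<^esub>"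
  using assms families_uminus[OF families_translate[of f "- q"]] by (auto simp: fun_eq_iff)

lemma group_translation_group: "group \<Gamma>"
proof (rule groupI)
  fix x y assume "x \<in> carrier \<Gamma>" "y \<in> carrier \<Gamma>"
  then show "x \<otimes>\<^bsub>\<Gamma>\<^esub> y \<in> carrier \<Gamma>"
    by (cases x; cases y) (simp add: families_add families_translate)
next
  fix x y z assume "x \<in> carrier \<Gamma>" "y \<in> carrier \<Gamma>" "z \<in> carrier \<Gamma>"
  show "x \<otimes>\<^bsub>\<Gamma>\<^esub> y \<otimes>\<^bsub>\<Gamma>\<^esub> z = x \<otimes>\<^bsub>\<Gamma>\<^esub> (y \<otimes>\<^bsub>\<Gamma>\<^esub> z)"
    by (cases x; cases y; cases z) (simp add: add.assoc)
next
  fix x assume "x \<in> carrier \<Gamma>"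
  then show "\<exists>y\<in>carrier \<Gamma>. y \<otimes>\<^bsub>\<Gamma>\<^esub> x = \<one>\<^bsub>\<Gamma>\<^esub>"
    using translation_group_inverse by (cases x) blast
next
  fix x assume "x \<in> carrier \<Gamma>"
  then show "\<one>\<^bsub>\<Gamma>\<^esub> \<otimes>\<^bsub>\<Gamma>\<^esub> x = x"
    by (cases x) simp
qed simp

interpretation \<Gamma>: group \<Gamma>
  by (rule group_translation_group)

lemma inv_translation_group [simp]:
  "f \<in> families \<Longrightarrow> q \<in> finitary \<Longrightarrow> inv\<^bsub>\<Gamma>\<^esub> (f, q) = ((\<lambda>n x. - f n (x + - q)), - q)"
  using translation_group_inverse[of f q] by (intro \<Gamma>.inv_equality) auto

section \<open>Derived length and infinite generation\<close>

lemma metabelian_translation_group: "metabelian \<Gamma>"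
proof -
  \<comment> \<open>\<open>B\<close> is the base of the split extension. It is abelian, and it
    contains all commutators because translation parts add up commutatively.\<close>
  define B where "B = families \<times> {0 :: nat \<Rightarrow> int}"
  have B: "subgroup B \<Gamma>"
  proof (rule \<Gamma>.subgroupI)
    have "(0, 0) \<in> B"
      by (simp add: B_def)
    then show "B \<noteq> {}"
      by blast
    show "B \<subseteq> carrier \<Gamma>"
      by (auto simp: B_def)
  next
    fix a assume "a \<in> B"
    then show "inv\<^bsub>\<Gamma>\<^esub> a \<in> B"
      by (auto simp: B_def families_uminus)
  next
    fix a b assume "a \<in> B" "b \<in> B"
    then show "a \<otimes>\<^bsub>\<Gamma>\<^esub> b \<in> B"
      by (auto simp: B_def families_add)
  qed
  have "derived_set \<Gamma> (carrier \<Gamma>) \<subseteq> B"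
  proof
    fix z assume z: "z \<in> derived_set \<Gamma> (carrier \<Gamma>)"
    then obtain f q g r where fg: "(f, q) \<in> carrier \<Gamma>" "(g, r) \<in> carrier \<Gamma>"
      and eq: "z = (f, q) \<otimes>\<^bsub>\<Gamma>\<^esub> (g, r) \<otimes>\<^bsub>\<Gamma>\<^esub> inv\<^bsub>\<Gamma>\<^esub> (f, q) \<otimes>\<^bsub>\<Gamma>\<^esub> inv\<^bsub>\<Gamma>\<^esub> (g, r)"
      by auto
    have "z \<in> carrier \<Gamma>"
      using eq fg by (metis \<Gamma>.m_closed \<Gamma>.inv_closed)
    moreover have "snd z = 0"
      using eq fg by simp
    ultimately show "z \<in> B"
      by (cases z) (simp add: B_def)
  qed
  then have "derived \<Gamma> (carrier \<Gamma>) \<subseteq> B"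
    unfolding derived_def using \<Gamma>.generate_subgroup_incl[OF _ B] by blast
  then have "derived \<Gamma> (derived \<Gamma> (carrier \<Gamma>)) \<subseteq> derived \<Gamma> B"
    by (rule \<Gamma>.mono_derived)
  also have "derived \<Gamma> B \<subseteq> {\<one>\<^bsub>\<Gamma>\<^esub>}"
    unfolding derived_def
    by (intro \<Gamma>.generate_subgroup_incl \<Gamma>.triv_subgroup) (auto simp: B_def families_add families_uminus fun_eq_iff)
  finally have "derived \<Gamma> (derived \<Gamma> (carrier \<Gamma>)) \<subseteq> {\<one>\<^bsub>\<Gamma>\<^esub>}" .
  moreover have "\<one>\<^bsub>\<Gamma>\<^esub> \<in> derived \<Gamma> (derived \<Gamma> (carrier \<Gamma>))"
    unfolding derived_def by (rule generate.one)
  ultimately show ?thesis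
    using \<Gamma>.is_group by (auto simp: metabelian_def)
qed

text \<open>Finitely many elements translate only coordinates below some \<open>k\<close>, and the
  elements that do not translate coordinate \<open>k\<close> form a proper subgroup.\<close>

lemma not_finitely_generated_translation_group: "\<not> finitely_generated \<Gamma>"
proof
  assume "finitely_generated \<Gamma>"
  then obtain S where S: "finite S" "S \<subseteq> carrier \<Gamma>" "generate \<Gamma> S = carrier \<Gamma>"
    by (auto simp: finitely_generated_def)
  have "\<exists>k. \<forall>(f, q)\<in>S. \<forall>i\<ge>k. q i = 0"
    using S(1,2)
  proof (induction rule: finite_induct)
    case (insert a S)
    obtain f q where a: "a = (f, q)" by (cases a)
    obtain k where k: "\<forall>(f, q)\<in>S. \<forall>i\<ge>k. q i = 0"
      using insert by auto
    obtain l where l: "\<forall>i\<ge>l. q i = 0"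
      using insert.prems a by (auto simp: finitary_def)
    have "\<forall>(f, q)\<in>insert a S. \<forall>i\<ge>max k l. q i = 0"
      using k l a by auto
    then show ?case by blast
  qed simp
  then obtain k where k: "\<forall>(f, q)\<in>S. \<forall>i\<ge>k. q i = 0" ..
  define K where "K = {(f, q). f \<in> families \<and> q \<in> finitary \<and> q k = 0}"
  have "subgroup K \<Gamma>"
  proof (rule \<Gamma>.subgroupI)
    have "(0, 0) \<in> K"
      by (simp add: K_def)
    then show "K \<noteq> {}"
      by blast
    show "K \<subseteq> carrier \<Gamma>"
      by (auto simp: K_def)
  next
    fix a assume "a \<in> K"
    then show "inv\<^bsub>\<Gamma>\<^esub> a \<in> K"
      by (auto simp: K_def intro!: families_uminus families_translate simp del: add_uminus_conv_diff)
  next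
    fix a b assume "a \<in> K" "b \<in> K"
    then show "a \<otimes>\<^bsub>\<Gamma>\<^esub> b \<in> K"
      by (auto simp: K_def intro!: families_add families_translate)
  qed
  moreover have "S \<subseteq> K"
    using k S(2) by (auto simp: K_def)
  ultimately have "carrier \<Gamma> \<subseteq> K"
    using \<Gamma>.generate_subgroup_incl S(3) by blast
  then have "(0, unit_vec k) \<in> K"
    by auto
  then show False
    by (simp add: K_def unit_vec_def)
qed

section \<open>Powers, congruence subgroups and residual finiteness\<close>

lemma snd_pow_translation_group:
  assumes "(f, q) \<in> carrier \<Gamma>"
  shows "snd ((f, q) [^]\<^bsub>\<Gamma>\<^esub> (k :: nat)) i = int k * q i"
proof (induction k)
  case (Suc k)
  then show ?case
    by (cases "(f, q) [^]\<^bsub>\<Gamma>\<^esub> k") (simp add: algebra_simps)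
qed simp

text \<open>Modulo \<open>m\<close> a translation by multiples of \<open>m\<close> acts trivially,
  so powers are computed as in a direct product.\<close>

lemma fst_pow_translation_group_cong:
  assumes "(f, q) \<in> carrier \<Gamma>" and q: "\<And>i. i < n \<Longrightarrow> m dvd q i"
  shows "m dvd fst ((f, q) [^]\<^bsub>\<Gamma>\<^esub> (k :: nat)) n x - int k * f n x"
proof (induction k)
  case (Suc k)
  obtain g r where gr: "(f, q) [^]\<^bsub>\<Gamma>\<^esub> k = (g, r)"
    by fastforce
  have "r i = int k * q i" for i
    using snd_pow_translation_group[OF assms(1), of k i] gr by simp
  then have "m dvd f n (x + r) - f n x"
    using assms by (intro multiaffine_translate_dvd[of n]) (auto simp: families_def)
  moreover have "m dvd g n x - int k * f n x"
    using Suc gr by simp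
  ultimately have "m dvd (f n (x + r) - f n x) + (g n x - int k * f n x)"
    by (rule dvd_add)
  then show ?case
    using gr by (simp add: algebra_simps)
qed simp

text \<open>This is the kernel of the map that keeps only the \<open>n\<close>-th function and the
  first \<open>n\<close> translation coordinates, all reduced modulo \<open>m\<close>.\<close>

definition congruence_subgroup :: "nat \<Rightarrow> int \<Rightarrow> (family \<times> (nat \<Rightarrow> int)) set" where
  "congruence_subgroup n m =
     {(f, q). (f, q) \<in> carrier \<Gamma> \<and> (\<forall>x. m dvd f n x) \<and> (\<forall>i<n. m dvd q i)}"

text \<open>Conjugating \<open>(g, r)\<close> by \<open>(f, q)\<close> translates \<open>g\<close>
  and subtracts the increment of \<open>f\<close> under translation by \<open>r\<close>. That
  increment is divisible by \<open>m\<close> because \<open>r\<close> is, in the coordinates that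
  count.\<close>

lemma normal_congruence_subgroup: "congruence_subgroup n m \<lhd> \<Gamma>"
proof (rule \<Gamma>.normal_invI)
  show "subgroup (congruence_subgroup n m) \<Gamma>"
  proof (rule \<Gamma>.subgroupI)
    have "(0, 0) \<in> congruence_subgroup n m"
      by (simp add: congruence_subgroup_def)
    then show "congruence_subgroup n m \<noteq> {}"
      by blast
    show "congruence_subgroup n m \<subseteq> carrier \<Gamma>"
      by (auto simp: congruence_subgroup_def)
  next
    fix a assume "a \<in> congruence_subgroup n m"
    then show "inv\<^bsub>\<Gamma>\<^esub> a \<in> congruence_subgroup n m"
      by (auto simp: congruence_subgroup_def intro!: families_uminus families_translate
          simp del: add_uminus_conv_diff)
  next
    fix a b assume "a \<in> congruence_subgroup n m" "b \<in> congruence_subgroup n m"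
    then show "a \<otimes>\<^bsub>\<Gamma>\<^esub> b \<in> congruence_subgroup n m"
      by (auto simp: congruence_subgroup_def intro!: families_add families_translate)
  qed
next
  fix a b assume a: "a \<in> carrier \<Gamma>" and b: "b \<in> congruence_subgroup n m"
  obtain f q g r where ab: "a = (f, q)" "b = (g, r)"
    by fastforce
  have fg: "f \<in> families" "q \<in> finitary" "g \<in> families" "r \<in> finitary"
    and g: "\<And>x. m dvd g n x" and r: "\<And>i. i < n \<Longrightarrow> m dvd r i"
    using a b ab by (auto simp: congruence_subgroup_def)
  have closed: "a \<otimes>\<^bsub>\<Gamma>\<^esub> b \<otimes>\<^bsub>\<Gamma>\<^esub> inv\<^bsub>\<Gamma>\<^esub> a \<in> carrier \<Gamma>"
    using a fg by (simp add: ab \<Gamma>.m_closed del: inv_translation_group mult_translation_group)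
  have eq: "a \<otimes>\<^bsub>\<Gamma>\<^esub> b \<otimes>\<^bsub>\<Gamma>\<^esub> inv\<^bsub>\<Gamma>\<^esub> a = ((\<lambda>n x. f n x + g n (x + q) - f n (x + r)), r)"
    using fg by (simp add: ab fun_eq_iff)
  have "m dvd f n x + g n (x + q) - f n (x + r)" for x
  proof -
    have "m dvd g n (x + q) - (f n (x + r) - f n x)"
      using g r fg by (intro dvd_diff multiaffine_translate_dvd[of n]) (auto simp: families_def)
    then show ?thesis
      by (simp add: algebra_simps)
  qed
  then show "a \<otimes>\<^bsub>\<Gamma>\<^esub> b \<otimes>\<^bsub>\<Gamma>\<^esub> inv\<^bsub>\<Gamma>\<^esub> a \<in> congruence_subgroup n m"
    using closed r unfolding eq congruence_subgroup_def by simp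
qed

lemma finite_rcosets_congruence_subgroup:
  assumes "m > 0"
  shows "finite (rcosets\<^bsub>\<Gamma>\<^esub> congruence_subgroup n m)"
proof -
  let ?N = "congruence_subgroup n m"
  define cube where "cube S = (\<lambda>i. of_bool (i \<in> S) :: int)" for S :: "nat set"
  \<comment> \<open>The signature records residues of the \<open>n\<close>-th function at the cube
    vertices and of the first \<open>n\<close> translation coordinates. It takes finitely many
    values, and equal signatures will force equal cosets.\<close>
  define sig where "sig = (\<lambda>(f :: family, q :: nat \<Rightarrow> int). (restrict (\<lambda>S. f n (cube S) mod m) (Pow {..<n}),
                                     restrict (\<lambda>i. q i mod m) {..<n}))"
  have sub: "subgroup ?N \<Gamma>"
    using normal_congruence_subgroup normal_imp_subgroup by blast
  have "sig ` carrier \<Gamma> \<subseteq> (Pow {..<n} \<rightarrow>\<^sub>E {0..<m}) \<times> ({..<n} \<rightarrow>\<^sub>E {0..<m})"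
    using assms by (auto simp: sig_def PiE_def Pi_def)
  then have fin: "finite (sig ` carrier \<Gamma>)"
    by (rule finite_subset) (auto intro!: finite_PiE)
  have coset: "?N #>\<^bsub>\<Gamma>\<^esub> a = ?N #>\<^bsub>\<Gamma>\<^esub> b"
    if ab: "a \<in> carrier \<Gamma>" "b \<in> carrier \<Gamma>" "sig a = sig b" for a b
  proof -
    obtain f q g r where eqs: "a = (f, q)" "b = (g, r)"
      by fastforce
    have fg: "f \<in> families" "q \<in> finitary" "g \<in> families" "r \<in> finitary"
      using ab eqs by auto
    have diff: "multiaffine n (\<lambda>x. f n x - g n x)"
      using fg by (simp add: multiaffine_diff families_multiaffine)
    have "m dvd f n (cube S) - g n (cube S)" if "S \<subseteq> {..<n}" for S
      using that fun_cong[OF arg_cong[OF ab(3), of fst], of S]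
      by (simp add: sig_def eqs mod_eq_dvd_iff)
    then have "m dvd f n x - g n x" for x
      unfolding cube_def by (rule multiaffine_dvd_if_dvd_on_cube[OF diff])
    then have g: "m dvd g n x - f n x" for x
      by (metis dvd_minus_iff minus_diff_eq)
    have qr: "m dvd r i - q i" if "i < n" for i
      using that fun_cong[OF arg_cong[OF ab(3)[symmetric], of snd], of i]
      by (simp add: sig_def eqs mod_eq_dvd_iff)
    have closed: "b \<otimes>\<^bsub>\<Gamma>\<^esub> inv\<^bsub>\<Gamma>\<^esub> a \<in> carrier \<Gamma>"
      using ab by simp
    have eq: "b \<otimes>\<^bsub>\<Gamma>\<^esub> inv\<^bsub>\<Gamma>\<^esub> a = ((\<lambda>n x. g n x - f n (x + (r - q))), r - q)"
      using fg by (simp add: eqs algebra_simps)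
    have "m dvd g n x - f n (x + (r - q))" for x
    proof -
      have "m dvd (g n x - f n x) - (f n (x + (r - q)) - f n x)"
        using qr fg by (intro dvd_diff[OF g] multiaffine_translate_dvd[OF families_multiaffine]) auto
      then show ?thesis
        by simp
    qed
    then have "b \<otimes>\<^bsub>\<Gamma>\<^esub> inv\<^bsub>\<Gamma>\<^esub> a \<in> ?N"
      using closed qr unfolding eq congruence_subgroup_def by simp
    then have "b \<in> ?N #>\<^bsub>\<Gamma>\<^esub> a"
      using ab sub \<Gamma>.is_group subgroup.rcos_module_rev by metis
    then show ?thesis
      using \<Gamma>.repr_independence sub ab by blast
  qed
  \<comment> \<open>Each coset is recovered from the signature of any of its elements through a
    chosen representative.\<close>
  have "rcosets\<^bsub>\<Gamma>\<^esub> ?N \<subseteq> (\<lambda>s. ?N #>\<^bsub>\<Gamma>\<^esub> inv_into (carrier \<Gamma>) sig s) ` sig ` carrier \<Gamma>"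
  proof
    fix X assume "X \<in> rcosets\<^bsub>\<Gamma>\<^esub> ?N"
    then obtain a where a: "a \<in> carrier \<Gamma>" "X = ?N #>\<^bsub>\<Gamma>\<^esub> a"
      by (auto simp: RCOSETS_def)
    then have "X = ?N #>\<^bsub>\<Gamma>\<^esub> inv_into (carrier \<Gamma>) sig (sig a)"
      using coset[OF a(1), of "inv_into (carrier \<Gamma>) sig (sig a)"]
        inv_into_into[of "sig a" sig "carrier \<Gamma>"] f_inv_into_f[of "sig a" sig "carrier \<Gamma>"]
      by simp
    then show "X \<in> (\<lambda>s. ?N #>\<^bsub>\<Gamma>\<^esub> inv_into (carrier \<Gamma>) sig s) ` sig ` carrier \<Gamma>"
      using a(1) by blast
  qed
  then show ?thesis
    using fin finite_subset by blast
qed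

text \<open>The first \<open>k\<close>-th power makes the translation part divisible by
  \<open>k\<close>. After that the action is trivial modulo \<open>k\<close>, so the second
  \<open>k\<close>-th power makes the function part divisible as well.\<close>

lemma pow_mem_congruence_subgroup:
  assumes a: "a \<in> carrier \<Gamma>"
  shows "a [^]\<^bsub>\<Gamma>\<^esub> (k * k) \<in> congruence_subgroup n (int k)"
proof -
  obtain f q where fq: "a [^]\<^bsub>\<Gamma>\<^esub> k = (f, q)"
    by fastforce
  obtain f' q' where a': "a = (f', q')"
    by fastforce
  have closed: "(f, q) \<in> carrier \<Gamma>"
    using fq a \<Gamma>.nat_pow_closed by metis
  have q: "int k dvd q i" for i
    using snd_pow_translation_group[of f' q' k i] a fq a' by simp
  have eq: "a [^]\<^bsub>\<Gamma>\<^esub> (k * k) = (f, q) [^]\<^bsub>\<Gamma>\<^esub> k"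
    using \<Gamma>.nat_pow_pow[OF a] fq by metis
  obtain g r where gr: "(f, q) [^]\<^bsub>\<Gamma>\<^esub> k = (g, r)"
    by fastforce
  have "(g, r) \<in> carrier \<Gamma>"
    using gr closed \<Gamma>.nat_pow_closed by metis
  moreover have "int k dvd r i" for i
    using snd_pow_translation_group[OF closed, of k i] gr by simp
  moreover have "int k dvd g n x" for x
  proof -
    have "int k dvd g n x - int k * f n x"
      using fst_pow_translation_group_cong[OF closed, of n "int k" k x] q gr by simp
    then show ?thesis
      by (simp add: dvd_diff_left_iff)
  qed
  ultimately show ?thesis
    by (simp add: eq gr congruence_subgroup_def)
qed

lemma residually_finite_p_group_translation_group:
  assumes p: "prime p"
  shows "residually_finite_p_group p \<Gamma>"
  unfolding residually_finite_p_group_def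
proof (intro ballI impI)
  fix g assume g: "g \<in> carrier \<Gamma>" "g \<noteq> \<one>\<^bsub>\<Gamma>\<^esub>"
  obtain f q where fq: "g = (f, q)"
    by fastforce
  \<comment> \<open>A nonzero integer \<open>v\<close> is smaller in absolute value than
    \<open>p\<close> to the power \<open>\<bar>v\<bar>\<close>, so some entry of a nontrivial
    element survives reduction modulo a suitable power of \<open>p\<close>.\<close>
  have not_dvd: "\<not> int (p ^ nat \<bar>v\<bar>) dvd v" if "v \<noteq> 0" for v :: int
  proof
    assume "int (p ^ nat \<bar>v\<bar>) dvd v"
    then have "int (p ^ nat \<bar>v\<bar>) \<le> \<bar>v\<bar>"
      using that zdvd_imp_le[of "int (p ^ nat \<bar>v\<bar>)" "\<bar>v\<bar>"] by simp
    moreover have "nat \<bar>v\<bar> < p ^ nat \<bar>v\<bar>"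
      using p power_gt_expt prime_gt_Suc_0_nat by blast
    ultimately show False by linarith
  qed
  have "\<exists>n k. g \<notin> congruence_subgroup n (int (p ^ k))"
  proof (cases "q = 0")
    case False
    then obtain i where "q i \<noteq> 0"
      by (auto simp: fun_eq_iff)
    \<comment> \<open>The level is \<open>Suc i\<close> because level \<open>n\<close> tests only
      translation coordinates below \<open>n\<close>.\<close>
    then have "g \<notin> congruence_subgroup (Suc i) (int (p ^ nat \<bar>q i\<bar>))"
      using not_dvd by (auto simp: fq congruence_subgroup_def)
    then show ?thesis by blast
  next
    case True
    then have "f \<noteq> 0"
      using g fq by auto
    then obtain n x where "f n x \<noteq> 0"
      by (auto simp: fun_eq_iff)
    then have "g \<notin> congruence_subgroup n (int (p ^ nat \<bar>f n x\<bar>))"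
      using not_dvd by (auto simp: fq congruence_subgroup_def)
    then show ?thesis by blast
  qed
  then obtain n k where nk: "g \<notin> congruence_subgroup n (int (p ^ k))"
    by blast
  have "finite_p_group p (\<Gamma> Mod congruence_subgroup n (int (p ^ k)))"
  proof (rule normal.FactGroup_finite_p_group[OF normal_congruence_subgroup])
    show "finite (rcosets\<^bsub>\<Gamma>\<^esub> congruence_subgroup n (int (p ^ k)))"
      using p by (intro finite_rcosets_congruence_subgroup) (simp add: prime_gt_0_nat)
    show "x [^]\<^bsub>\<Gamma>\<^esub> (p ^ (k + k)) \<in> congruence_subgroup n (int (p ^ k))" if "x \<in> carrier \<Gamma>" for x
      using pow_mem_congruence_subgroup[OF that, of "p ^ k" n] by (simp add: power_add)
  qed fact
  then show "\<exists>N. N \<lhd> \<Gamma> \<and> g \<notin> N \<and> finite_p_group p (\<Gamma> Mod N)"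
    using nk normal_congruence_subgroup by blast
qed

section \<open>The generating set\<close>

text \<open>The second kind of element is a basis translation times a base element that commutes
  with it.\<close>

definition malcev_set :: "(family \<times> (nat \<Rightarrow> int)) set" where
  "malcev_set = families \<times> {0} \<union>
     {(f, unit_vec i) | f i. f \<in> families \<and> (\<forall>n x. f n (x + unit_vec i) = f n x)}"

lemma malcev_set_cases:
  assumes "a \<in> malcev_set"
  obtains (base) f where "a = (f, 0)" "f \<in> families"
  | (top) f i where "a = (f, unit_vec i)" "f \<in> families" "\<And>n x. f n (x + unit_vec i) = f n x"
  using assms by (auto simp: malcev_set_def)

lemma malcev_set_subset: "malcev_set \<subseteq> carrier \<Gamma>"
  by (auto simp: malcev_set_def)

text \<open>Only elements \<open>f e_i\<close> need an argument. Conjugation by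
  \<open>(h, q)\<close> keeps the translation \<open>e_i\<close>, translates \<open>f\<close>, and
  adds a first difference of \<open>h\<close> in direction \<open>i\<close>; the latter is again
  invariant under \<open>e_i\<close> because second differences vanish.\<close>

lemma normal_subset_malcev_set: "normal_subset \<Gamma> malcev_set"
  unfolding normal_subset_def
proof (intro conjI ballI malcev_set_subset)
  fix g t assume g: "g \<in> carrier \<Gamma>" and t: "t \<in> malcev_set"
  obtain h q where hq: "g = (h, q)" "h \<in> families" "q \<in> finitary"
    using g by (cases g) auto
  have closed: "inv\<^bsub>\<Gamma>\<^esub> g \<otimes>\<^bsub>\<Gamma>\<^esub> t \<otimes>\<^bsub>\<Gamma>\<^esub> g \<in> carrier \<Gamma>"
    using g t malcev_set_subset by (intro \<Gamma>.m_closed \<Gamma>.inv_closed) auto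
  from t show "inv\<^bsub>\<Gamma>\<^esub> g \<otimes>\<^bsub>\<Gamma>\<^esub> t \<otimes>\<^bsub>\<Gamma>\<^esub> g \<in> malcev_set"
  proof (cases rule: malcev_set_cases)
    case (base f)
    then show ?thesis
      using closed hq by (simp add: malcev_set_def)
  next
    case (top f i)
    define u where "u = (\<lambda>n x. - h n (x - q) + f n (x - q) + h n (x + (unit_vec i - q)))"
    have eq: "inv\<^bsub>\<Gamma>\<^esub> g \<otimes>\<^bsub>\<Gamma>\<^esub> t \<otimes>\<^bsub>\<Gamma>\<^esub> g = (u, unit_vec i)"
      using hq top by (simp add: u_def fun_eq_iff)
    have "u n (x + unit_vec i) = u n x" for n x
    proof -
      have "f n (x + unit_vec i - q) = f n (x - q)"
        using top(3)[of n "x - q"] by (simp add: algebra_simps)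
      moreover have "x + unit_vec i + (unit_vec i - q) = x - q + (unit_vec i + unit_vec i)"
        "x + (unit_vec i - q) = x - q + unit_vec i" "x + unit_vec i - q = x - q + unit_vec i"
        by (simp_all add: algebra_simps)
      moreover have "h n (x - q + (unit_vec i + unit_vec i)) = 2 * h n (x - q + unit_vec i) - h n (x - q)"
        using multiaffine_second_difference families_multiaffine[OF hq(2)] by blast
      ultimately show ?thesis
        unfolding u_def by (simp only:)
    qed
    then show ?thesis
      using closed unfolding eq by (auto simp: malcev_set_def)
  qed
qed

text \<open>Every commutator has trivial translation part, and the whole base lies in the
  set.\<close>

lemma commutator_closed_malcev_set: "commutator_closed \<Gamma> malcev_set"
  unfolding commutator_closed_def
proof (intro ballI)
  fix x y assume xy: "x \<in> malcev_set" "y \<in> malcev_set"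
  let ?c = "inv\<^bsub>\<Gamma>\<^esub> x \<otimes>\<^bsub>\<Gamma>\<^esub> inv\<^bsub>\<Gamma>\<^esub> y \<otimes>\<^bsub>\<Gamma>\<^esub> x \<otimes>\<^bsub>\<Gamma>\<^esub> y"
  have carr: "x \<in> carrier \<Gamma>" "y \<in> carrier \<Gamma>"
    using xy malcev_set_subset by auto
  then have "?c \<in> carrier \<Gamma>"
    by simp
  moreover have "snd ?c = 0"
    using carr by (cases x; cases y) simp
  ultimately show "?c \<in> malcev_set"
    by (cases ?c) (simp add: malcev_set_def)
qed

text \<open>This is the Malcev law of level 2. Translation parts agree on both sides, so only
  functions are compared, by the vanishing of second differences and the invariance built into
  \<open>malcev_set\<close>.\<close>

lemma malcev_set_products_commute:
  assumes "a \<in> malcev_set" "b \<in> malcev_set"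
  shows "(a \<otimes>\<^bsub>\<Gamma>\<^esub> b) \<otimes>\<^bsub>\<Gamma>\<^esub> (b \<otimes>\<^bsub>\<Gamma>\<^esub> a) = (b \<otimes>\<^bsub>\<Gamma>\<^esub> a) \<otimes>\<^bsub>\<Gamma>\<^esub> (a \<otimes>\<^bsub>\<Gamma>\<^esub> b)"
proof -
  have dd: "f n (x + (unit_vec i + unit_vec i)) = 2 * f n (x + unit_vec i) - f n x"
    if "f \<in> families" for f :: family and n x i
    using that multiaffine_second_difference families_multiaffine by blast
  from assms(1) show ?thesis
  proof (cases rule: malcev_set_cases)
    case a: (base f)
    from assms(2) show ?thesis
    proof (cases rule: malcev_set_cases)
      case (base g)
      then show ?thesis using a by (simp add: add_ac)
    next
      case (top g j)
      then show ?thesis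
        using a dd[OF a(2)] by (simp add: fun_eq_iff add.assoc)
    qed
  next
    case a: (top f i)
    from assms(2) show ?thesis
    proof (cases rule: malcev_set_cases)
      case (base g)
      then show ?thesis
        using a dd[OF base(2)] by (simp add: fun_eq_iff add.assoc)
    next
      case b: (top g j)
      \<comment> \<open>Since \<open>f\<close> is invariant under \<open>unit_vec i\<close> and
        \<open>g\<close> under \<open>unit_vec j\<close>, both sides reduce to
        \<open>2 * f n (x + unit_vec j) + 2 * g n (x + unit_vec i)\<close>.\<close>
      have "f n x + g n (x + unit_vec i)
            + (g n (x + (unit_vec i + unit_vec j)) + f n (x + (unit_vec i + unit_vec j) + unit_vec j))
          = g n x + f n (x + unit_vec j)
            + (f n (x + (unit_vec j + unit_vec i)) + g n (x + (unit_vec j + unit_vec i) + unit_vec i))" for n x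
      proof -
        have "x + (unit_vec i + unit_vec j) + unit_vec j = x + (unit_vec j + unit_vec j) + unit_vec i"
          "x + (unit_vec j + unit_vec i) + unit_vec i = x + (unit_vec i + unit_vec i) + unit_vec j"
          "x + (unit_vec i + unit_vec j) = x + unit_vec i + unit_vec j"
          "x + (unit_vec j + unit_vec i) = x + unit_vec j + unit_vec i"
          by (simp_all add: algebra_simps)
        then show ?thesis
          unfolding a(3) b(3) dd[OF a(2), of n x j] dd[OF b(2), of n x i]
          by (simp only: a(3) b(3) dd[OF a(2)] dd[OF b(2)])
      qed
      then show ?thesis
        using a(1) b(1) by (simp add: add.commute[of "unit_vec j" "unit_vec i"])
    qed
  qed
qed

text \<open>The set contains the base and, with zero function part, every basis translation; integer
  multiples and finite sums of the latter give all of \<open>finitary\<close>.\<close>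

lemma generate_malcev_set: "generate \<Gamma> malcev_set = carrier \<Gamma>"
proof
  show "generate \<Gamma> malcev_set \<subseteq> carrier \<Gamma>"
    using \<Gamma>.generate_incl malcev_set_subset by blast
next
  let ?S = "generate \<Gamma> malcev_set"
  have sub: "subgroup ?S \<Gamma>"
    using \<Gamma>.generate_is_subgroup malcev_set_subset by blast
  have unit: "(0, unit_vec i) \<in> ?S" for i
    by (rule generate.incl) (auto simp: malcev_set_def)
  have mult: "(0, q + r) \<in> ?S" if "(0, q) \<in> ?S" "(0, r) \<in> ?S" for q r
    using subgroup.m_closed[OF sub that] by (simp add: zero_fun_def)
  have neg: "(0, - q) \<in> ?S" if "(0, q) \<in> ?S" for q
  proof -
    have "q \<in> finitary"
      using that subgroup.mem_carrier[OF sub] by fastforce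
    then have inv_eq: "inv\<^bsub>\<Gamma>\<^esub> (0, q) = (0, - q)"
      by (simp add: fun_eq_iff)
    show ?thesis
      using subgroup.m_inv_closed[OF sub that] inv_eq by simp
  qed
  have zero: "(0, 0) \<in> ?S"
    using subgroup.one_closed[OF sub] by simp
  have scale_nat: "(0, \<lambda>j. int k * unit_vec i j) \<in> ?S" for i k
  proof (induction k)
    case 0
    then show ?case using zero by (simp add: zero_fun_def)
  next
    case (Suc k)
    have "unit_vec i + (\<lambda>j. int k * unit_vec i j) = (\<lambda>j. int (Suc k) * unit_vec i j)"
      by (simp add: fun_eq_iff algebra_simps)
    then show ?case
      using mult[OF unit[of i] Suc.IH] by (simp only:)
  qed
  have scale: "(0, \<lambda>j. c * unit_vec i j) \<in> ?S" for i and c :: int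
  proof (cases "c \<ge> 0")
    case True
    then show ?thesis using scale_nat[of "nat c" i] by simp
  next
    case False
    then show ?thesis using neg[OF scale_nat[of "nat (- c)" i]] by (simp add: fun_Compl_def)
  qed
  have "(0, q) \<in> ?S" if "\<forall>i\<ge>k. q i = 0" for k q
    using that
  proof (induction k arbitrary: q)
    case 0
    then have "q = 0" by (auto simp: fun_eq_iff)
    then show ?case using zero by (simp only:)
  next
    case (Suc k)
    have "(0, q(k := 0)) \<in> ?S"
      using Suc.prems by (intro Suc.IH) (metis Suc_leI fun_upd_apply le_neq_implies_less)
    moreover have "q(k := 0) + (\<lambda>j. q k * unit_vec k j) = q"
      by (simp add: fun_eq_iff unit_vec_def)
    ultimately show ?case
      using mult[OF _ scale[of "q k" k], of "q(k := 0)"] by (simp only:)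
  qed
  then have Q: "(0, q) \<in> ?S" if "q \<in> finitary" for q
    using that by (auto simp: finitary_def)
  show "carrier \<Gamma> \<subseteq> ?S"
  proof
    fix a assume a: "a \<in> carrier \<Gamma>"
    obtain f q where fq: "a = (f, q)" by fastforce
    have "(f, 0) \<in> ?S"
      using a fq by (intro generate.incl) (auto simp: malcev_set_def)
    from subgroup.m_closed[OF sub this Q[of q]] show "a \<in> ?S"
      using a fq by simp
  qed
qed

section \<open>No positive law\<close>

text \<open>All variables translate by the same \<open>s\<close>, so a letter at position
  \<open>j\<close> is preceded by the translation \<open>j * s\<close>. The sum thus evaluates
  \<open>\<phi>\<close> along the positions at which \<open>a\<close> occurs.\<close>

lemma eval_word_translation_group:
  assumes "\<And>v. \<theta> v = (if v = a then \<phi> else 0, s)"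
  shows "fst (eval_word \<Gamma> \<theta> w) n x
       = (\<Sum>j<length w. if w ! j = a then \<phi> n (\<lambda>i. x i + int j * s i) else 0)"
proof (induction w arbitrary: x)
  case (Cons v w)
  have shift: "(\<lambda>i. (x + s) i + int j * s i) = (\<lambda>i. x i + int (Suc j) * s i)" for j
    by (simp add: fun_eq_iff algebra_simps)
  have "fst (eval_word \<Gamma> \<theta> (v # w)) n x
      = (if v = a then \<phi> n x else 0) + fst (eval_word \<Gamma> \<theta> w) n (x + s)"
    by (cases "eval_word \<Gamma> \<theta> w") (simp add: assms)
  also have "\<dots> = (\<Sum>j<length (v # w). if (v # w) ! j = a then \<phi> n (\<lambda>i. x i + int j * s i) else 0)"
    unfolding Cons.IH shift by (simp add: sum.lessThan_Suc_shift del: sum.lessThan_Suc)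
  finally show ?case .
qed simp

lemma snd_eval_word_translation_group:
  assumes "\<And>v. \<theta> v = (g v, s)"
  shows "snd (eval_word \<Gamma> \<theta> w) i = int (length w) * s i"
proof (induction w)
  case (Cons v w)
  then show ?case
    using assms[of v] by (cases "eval_word \<Gamma> \<theta> w") (simp add: algebra_simps)
qed simp

lemma no_positive_law_translation_group: "\<not> satisfies_positive_law \<Gamma>"
proof
  assume "satisfies_positive_law \<Gamma>"
  then obtain \<alpha> \<beta> where neq: "\<alpha> \<noteq> \<beta>" and law: "satisfies_law \<Gamma> (carrier \<Gamma>) \<alpha> \<beta>"
    by (auto simp: satisfies_positive_law_def)
  \<comment> \<open>Substituting one basis translation for every variable counts letters, so the two
    words have the same length.\<close>
  have "eval_word \<Gamma> (\<lambda>_. (0, unit_vec 0)) \<alpha> = eval_word \<Gamma> (\<lambda>_. (0, unit_vec 0)) \<beta>"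
    using law by (simp add: satisfies_law_def)
  then have "int (length \<alpha>) * unit_vec 0 0 = int (length \<beta>) * unit_vec 0 0"
    using snd_eval_word_translation_group[of "\<lambda>_. (0, unit_vec 0)" "\<lambda>_. 0" "unit_vec 0" _ 0] by metis
  then have len: "length \<beta> = length \<alpha>"
    by (simp add: unit_vec_def)
  define L where "L = length \<alpha>"
  obtain m where m: "m < L" "\<alpha> ! m \<noteq> \<beta> ! m"
    using neq len nth_equalityI[of \<alpha> \<beta>] L_def by auto
  \<comment> \<open>Starting at the point with coordinates \<open>- i\<close> and moving along the
    diagonal \<open>s\<close>, after \<open>j\<close> steps one reaches coordinates
    \<open>j - i\<close> for \<open>i < L\<close>. The product over all \<open>i\<close> in
    \<open>I\<close> then vanishes for every \<open>j < L\<close> except \<open>j = m\<close>, which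
    isolates the position where the words differ.\<close>
  define I where "I = {..<L} - {m}"
  define s :: "nat \<Rightarrow> int" where "s = (\<lambda>i. if i < L then 1 else 0)"
  define \<phi> :: family where "\<phi> = (\<lambda>n x. if n = L then (\<Prod>i\<in>I. x i) else 0)"
  define \<theta> where "\<theta> v = (if v = \<alpha> ! m then \<phi> else 0, s)" for v
  define x :: "nat \<Rightarrow> int" where "x = (\<lambda>i. - int i)"
  have "multiaffine n (\<phi> n)" for n
    by (cases "n = L") (simp_all add: \<phi>_def I_def multiaffine_prod)
  then have "\<phi> \<in> families"
    unfolding families_def by (auto simp: \<phi>_def zero_fun_def intro!: exI[of _ "Suc L"])
  moreover have "s \<in> finitary"
    unfolding finitary_def s_def by (auto intro: exI[of _ L])
  ultimately have "\<theta> v \<in> carrier \<Gamma>" for v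
    by (simp add: \<theta>_def)
  then have "eval_word \<Gamma> \<theta> \<alpha> = eval_word \<Gamma> \<theta> \<beta>"
    using law by (simp add: satisfies_law_def)
  moreover have "fst (eval_word \<Gamma> \<theta> w) L x = (if w ! m = \<alpha> ! m then (\<Prod>i\<in>I. int m - int i) else 0)"
    if "length w = L" for w
  proof -
    have \<phi>: "\<phi> L (\<lambda>i. x i + int j * s i) = (if j = m then (\<Prod>i\<in>I. int m - int i) else 0)" if "j < L" for j
    proof -
      have "\<phi> L (\<lambda>i. x i + int j * s i) = (\<Prod>i\<in>I. int j - int i)"
        unfolding \<phi>_def by (auto simp: x_def s_def I_def intro!: prod.cong)
      moreover have "(\<Prod>i\<in>I. int j - int i) = 0" if "j \<noteq> m"
        using that \<open>j < L\<close> by (intro prod_zero) (auto simp: I_def)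
      ultimately show ?thesis by auto
    qed
    have "fst (eval_word \<Gamma> \<theta> w) L x
        = (\<Sum>j<L. if w ! j = \<alpha> ! m then \<phi> L (\<lambda>i. x i + int j * s i) else 0)"
      using eval_word_translation_group[of \<theta> "\<alpha> ! m" \<phi> s w L x] that by (simp add: \<theta>_def)
    also have "\<dots> = (\<Sum>j<L. if j = m then (if w ! m = \<alpha> ! m then (\<Prod>i\<in>I. int m - int i) else 0) else 0)"
      by (intro sum.cong) (auto simp: \<phi>)
    also have "\<dots> = (if w ! m = \<alpha> ! m then (\<Prod>i\<in>I. int m - int i) else 0)"
      using m by simp
    finally show ?thesis .
  qed
  \<comment> \<open>The word \<open>\<alpha>\<close> contributes this product, while
    \<open>\<beta>\<close> has another letter at position \<open>m\<close> and contributes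
    0.\<close>
  ultimately have "(\<Prod>i\<in>I. int m - int i) = 0"
    using m len L_def by (metis (full_types))
  then show False
    by (auto simp: I_def)
qed

section \<open>Countability\<close>

lemma countable_translation_group: "countable (carrier \<Gamma>)"
proof -
  define cube where "cube S = (\<lambda>i. of_bool (i \<in> S) :: int)" for S :: "nat set"
  define C where "C k = {(f, q) \<in> carrier \<Gamma>. (\<forall>n\<ge>k. f n = 0) \<and> (\<forall>i\<ge>k. q i = 0)}" for k
  have "countable (C k)" for k
  proof -
    obtain xs where xs: "set xs = {..<k} \<times> Pow {..<k}"
      using finite_list[of "{..<k} \<times> Pow {..<k}"] by auto
    \<comment> \<open>An element of \<open>C k\<close> is encoded by finitely many integers:
      function values at cube vertices and translation coordinates below \<open>k\<close>.\<close>
    define sig where "sig = (\<lambda>(f :: family, q :: nat \<Rightarrow> int).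
        (map (\<lambda>(n, S). f n (cube S)) xs, map q [0..<k]))"
    have "inj_on sig (C k)"
    proof (rule inj_onI)
      fix a b assume ab: "a \<in> C k" "b \<in> C k" "sig a = sig b"
      obtain f q g r where eqs: "a = (f, q)" "b = (g, r)"
        by fastforce
      have fg: "f \<in> families" "g \<in> families" "\<And>n. n \<ge> k \<Longrightarrow> f n = g n" "\<And>i. i \<ge> k \<Longrightarrow> q i = r i"
        using ab eqs by (auto simp: C_def)
      have "q i = r i" for i
        using ab(3) fg(4)[of i]
        by (cases "i < k") (auto simp: sig_def eqs)
      moreover have "f n x = g n x" for n x
      proof (cases "n < k")
        case True
        have diff: "multiaffine n (\<lambda>x. f n x - g n x)"
          using fg by (simp add: multiaffine_diff families_multiaffine)
        \<comment> \<open>Divisibility by 0 means equality, so the cube criterion shows that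
          functions agreeing at all vertices coincide.\<close>
        have "0 dvd f n (cube S) - g n (cube S)" if "S \<subseteq> {..<n}" for S
        proof -
          have "S \<subseteq> {..<k}"
            using that True by auto
          then show ?thesis
            using ab(3) True xs by (auto simp: sig_def eqs)
        qed
        then have "0 dvd f n x - g n x"
          unfolding cube_def by (rule multiaffine_dvd_if_dvd_on_cube[OF diff])
        then show ?thesis by simp
      qed (use fg(3)[of n] in auto)
      ultimately show "a = b"
        by (simp add: eqs fun_eq_iff)
    qed
    then show ?thesis
      by (rule countable_image_inj_on[rotated]) (rule countableI_type)
  qed
  moreover have "carrier \<Gamma> \<subseteq> (\<Union>k. C k)"
  proof
    fix a assume a: "a \<in> carrier \<Gamma>"
    obtain f q where fq: "a = (f, q)" by fastforce
    then obtain k l where "\<forall>n\<ge>k. f n = 0" "\<forall>i\<ge>l. q i = 0"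
      using a by (auto simp: families_def finitary_def)
    then have "a \<in> C (max k l)"
      using a fq by (auto simp: C_def)
    then show "a \<in> (\<Union>k. C k)" by blast
  qed
  ultimately show ?thesis
    by (meson countable_UN countable_subset countableI_type)
qed

section \<open>Transport to a group on the natural numbers\<close>

theorem theorem1:
  fixes c :: nat
  assumes "c \<ge> 3"
  shows "\<exists>G :: nat monoid.
           group G \<and> metabelian G \<and> \<not> finitely_generated G \<and>
           (\<forall>p :: nat. prime p \<longrightarrow> residually_finite_p_group p G) \<and>
           (\<exists>T. normal_subset G T \<and> commutator_closed G T \<and>
                generate G T = carrier G \<and>
                satisfies_law G T (malcev_\<alpha> c) (malcev_\<beta> c)) \<and>
           \<not> satisfies_positive_law G"
proof -
  obtain G :: "nat monoid" and h where G: "group G" and h: "h \<in> iso \<Gamma> G"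
    using countable_group_iso_nat[OF \<Gamma>.is_group countable_translation_group] .
  \<comment> \<open>Positive properties of the generating set are pushed forward along
    \<open>h\<close>. The two negative ones are obtained through the inverse \<open>h'\<close>:
    finite generation or a positive law in \<open>G\<close> would pass to its image
    \<open>\<Gamma>\<close>.\<close>
  define h' where "h' = inv_into (carrier \<Gamma>) h"
  have h': "h' \<in> iso G \<Gamma>"
    unfolding h'_def using \<Gamma>.iso_set_sym[OF h] .
  interpret G: group G by fact
  interpret h: group_hom \<Gamma> G h
    using h by unfold_locales (simp add: iso_def)
  interpret h': group_hom G \<Gamma> h'
    using h' by unfold_locales (simp add: iso_def)
  have surj: "h ` carrier \<Gamma> = carrier G" and surj': "h' ` carrier G = carrier \<Gamma>"
    using h h' by (auto simp: iso_def bij_betw_def)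
  have "metabelian G"
    using h.metabelian_image metabelian_translation_group surj by blast
  moreover have "\<not> finitely_generated G"
    using h'.finitely_generated_image not_finitely_generated_translation_group surj' by blast
  moreover have "\<forall>p. prime p \<longrightarrow> residually_finite_p_group p G"
    using residually_finite_p_group_iso[OF G \<Gamma>.is_group h'] residually_finite_p_group_translation_group by blast
  moreover have "normal_subset G (h ` malcev_set)"
    using h.normal_subset_image normal_subset_malcev_set surj by blast
  moreover have "commutator_closed G (h ` malcev_set)"
    using h.commutator_closed_image commutator_closed_malcev_set malcev_set_subset by blast
  moreover have "generate G (h ` malcev_set) = carrier G"
    using h.generate_img[OF malcev_set_subset] generate_malcev_set surj by simp
  moreover have "satisfies_law G (h ` malcev_set) (malcev_\<alpha> c) (malcev_\<beta> c)"
    using assms by (intro h.satisfies_law_image \<Gamma>.satisfies_law_malcev malcev_set_subset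
        malcev_set_products_commute) auto
  moreover have "\<not> satisfies_positive_law G"
    using h'.satisfies_law_image[OF subset_refl] no_positive_law_translation_group surj'
    unfolding satisfies_positive_law_def by metis
  ultimately show ?thesis
    using G by blast
qed

end
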